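(* Let $n\ge1$, let $a,b\in\mathcal A_n$ be such that $a,b,\tilde a,\tilde b$ are linearly independent elements of $\pm\mathcal E_n''$, and put $\chi=\gamma_n\frac{n(a)}{n(b)}\in\{\pm1\}$. (1) If $\chi=1$, then $(a,b)$ is orthogonal in $\mathcal A_{n+1}$ to itself and to $(b,\gamma_n a)$. (2) If $\chi=-1$, then $(a,b)$ is orthogonal in $\mathcal A_{n+1}$ to $(\tilde a,\tilde b)$ and to $(\tilde b,\gamma_n\tilde a)$.
   Context: Real Cayley–Dickson algebras: $\mathcal A_0=\mathbb R$ with trivial involution. Given parameters $\gamma_0,\gamma_1,\dots\in\{\pm1\}$ (the paper's normalization of nonzero real parameters), $\mathcal A_{k+1}=\mathcal A_k\times\mathcal A_k$ with componentwise addition and real scaling, product $(a,b)(c,d)=(ac+\gamma_k\bar d b,\ da+b\bar c)$ and involution $\overline{(a,b)}=(\bar a,-b)$. The norm is $n(a)=a\bar a\in\mathbb R$. Standard basis: $e^{(0)}_0=1$; $e^{(k+1)}_j=(e^{(k)}_j,0)$ for $0\le j<2^k$ and $e^{(k+1)}_j=(0,e^{(k)}_{j-2^k})$ for $2^k\le j<2^{k+1}$; $e_0=e_0^{(n)}$ is the unity. In $\mathcal A_n$, $\tilde e_0=(0,e_0)=e^{(n)}_{2^{n-1}}$ and $\tilde x=x\tilde e_0$. $\mathcal E_n''=\{e^{(n)}_0,\dots,e^{(n)}_{2^n-1}\}\setminus\{e_0,\tilde e_0\}$, $\pm X=X\cup(-X)$. Elements $x,y$ are orthogonal if $xy=yx=0$.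 *)

theory Defs
  imports Complex_Main "HOL-Library.Function_Algebras"
begin

instantiation "fun" :: (type, real_vector) real_vector
begin

definition scaleR_fun :: "real \<Rightarrow> ('a \<Rightarrow> 'b) \<Rightarrow> 'a \<Rightarrow> 'b" where
  "scaleR_fun r f = (\<lambda>i. r *\<^sub>R f i)"

instance
  by standard
    (simp_all add: scaleR_fun_def plus_fun_def fun_eq_iff scaleR_add_right scaleR_add_left)

end

text \<open>
  An element of the \<open>2^k\<close>-dimensional algebra \<open>A\<^sub>k\<close> is given by its real coordinates: it is a
  function on the naturals that vanishes outside \<open>{..<2^k}\<close>.  Addition, zero and real scaling are
  the pointwise ones.  The product of the algebra is \<open>cd_mult\<close>; the pointwise \<open>(*)\<close> and \<open>1\<close> on
  functions play no role.

  The identification of \<open>A\<^sub>k\<^sub>+\<^sub>1\<close> with \<open>A\<^sub>k \<times> A\<^sub>k\<close> is concatenation of coordinates (\<open>cd_pair k\<close>),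
  with \<open>cd_fst k\<close> and \<open>cd_snd k\<close> as the two projections (see \<open>cd_pair_bij\<close> below).
\<close>

definition cd_alg :: "nat \<Rightarrow> (nat \<Rightarrow> real) set" where
  "cd_alg k = {x. \<forall>i\<ge>2 ^ k. x i = 0}"

definition cd_pair :: "nat \<Rightarrow> (nat \<Rightarrow> real) \<Rightarrow> (nat \<Rightarrow> real) \<Rightarrow> (nat \<Rightarrow> real)" where
  "cd_pair k a b = (\<lambda>i. if i < 2 ^ k then a i else b (i - 2 ^ k))"

definition cd_fst :: "nat \<Rightarrow> (nat \<Rightarrow> real) \<Rightarrow> (nat \<Rightarrow> real)" where
  "cd_fst k x = (\<lambda>i. if i < 2 ^ k then x i else 0)"

definition cd_snd :: "nat \<Rightarrow> (nat \<Rightarrow> real) \<Rightarrow> (nat \<Rightarrow> real)" where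
  "cd_snd k x = (\<lambda>i. if i < 2 ^ k then x (2 ^ k + i) else 0)"

primrec cd_conj :: "nat \<Rightarrow> (nat \<Rightarrow> real) \<Rightarrow> (nat \<Rightarrow> real)" where
  "cd_conj 0 x = x"
| "cd_conj (Suc k) x = cd_pair k (cd_conj k (cd_fst k x)) (- cd_snd k x)"

text \<open>The first argument is the sequence of parameters \<open>\<gamma>\<close>; see \<open>cd_mult_pair\<close> below.\<close>

primrec cd_mult ::
  "(nat \<Rightarrow> real) \<Rightarrow> nat \<Rightarrow> (nat \<Rightarrow> real) \<Rightarrow> (nat \<Rightarrow> real) \<Rightarrow> (nat \<Rightarrow> real)" where
  "cd_mult \<gamma> 0 x y = (\<lambda>i. if i = 0 then x 0 * y 0 else 0)"
| "cd_mult \<gamma> (Suc k) x y =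
     (let a = cd_fst k x; b = cd_snd k x; c = cd_fst k y; d = cd_snd k y in
      cd_pair k
        (cd_mult \<gamma> k a c + \<gamma> k *\<^sub>R cd_mult \<gamma> k (cd_conj k d) b)
        (cd_mult \<gamma> k d a + cd_mult \<gamma> k b (cd_conj k c)))"

primrec cd_basis :: "nat \<Rightarrow> nat \<Rightarrow> (nat \<Rightarrow> real)" where
  "cd_basis 0 j = (\<lambda>i. if i = 0 then 1 else 0)"
| "cd_basis (Suc k) j =
     (if j < 2 ^ k then cd_pair k (cd_basis k j) 0 else cd_pair k 0 (cd_basis k (j - 2 ^ k)))"

text \<open>
  The norm is the real number \<open>r\<close> with \<open>a \<cdot> conj a = r \<cdot> e\<^sub>0\<close>; it exists and is unique for every
  \<open>a \<in> A\<^sub>k\<close> (see \<open>cd_norm_eq\<close> below).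
\<close>

definition cd_norm :: "(nat \<Rightarrow> real) \<Rightarrow> nat \<Rightarrow> (nat \<Rightarrow> real) \<Rightarrow> real" where
  "cd_norm \<gamma> k a = (THE r. cd_mult \<gamma> k a (cd_conj k a) = r *\<^sub>R cd_basis k 0)"

text \<open>The following three definitions are meant for \<open>n \<ge> 1\<close> only.\<close>

definition cd_te0 :: "nat \<Rightarrow> (nat \<Rightarrow> real)" where
  "cd_te0 n = cd_basis n (2 ^ (n - 1))"

definition cd_tilde :: "(nat \<Rightarrow> real) \<Rightarrow> nat \<Rightarrow> (nat \<Rightarrow> real) \<Rightarrow> (nat \<Rightarrow> real)" where
  "cd_tilde \<gamma> n x = cd_mult \<gamma> n x (cd_te0 n)"

definition cd_E2 :: "nat \<Rightarrow> (nat \<Rightarrow> real) set" where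
  "cd_E2 n = cd_basis n ` {..<2 ^ n} - {cd_basis n 0, cd_te0 n}"

definition plus_minus :: "(nat \<Rightarrow> real) set \<Rightarrow> (nat \<Rightarrow> real) set" where
  "plus_minus X = X \<union> uminus ` X"

definition cd_orthogonal ::
  "(nat \<Rightarrow> real) \<Rightarrow> nat \<Rightarrow> (nat \<Rightarrow> real) \<Rightarrow> (nat \<Rightarrow> real) \<Rightarrow> bool" where
  "cd_orthogonal \<gamma> k x y \<longleftrightarrow> cd_mult \<gamma> k x y = 0 \<and> cd_mult \<gamma> k y x = 0"

lemma cd_fst_pair [simp]: "a \<in> cd_alg k \<Longrightarrow> cd_fst k (cd_pair k a b) = a"
  by (auto simp: cd_alg_def cd_fst_def cd_pair_def fun_eq_iff)

lemma cd_snd_pair [simp]: "b \<in> cd_alg k \<Longrightarrow> cd_snd k (cd_pair k a b) = b"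
  by (auto simp: cd_alg_def cd_snd_def cd_pair_def fun_eq_iff)

lemma cd_fst_in_alg [simp]: "cd_fst k x \<in> cd_alg k"
  by (simp add: cd_alg_def cd_fst_def)

lemma cd_snd_in_alg [simp]: "cd_snd k x \<in> cd_alg k"
  by (simp add: cd_alg_def cd_snd_def)

lemma cd_pair_in_alg [simp]: "b \<in> cd_alg k \<Longrightarrow> cd_pair k a b \<in> cd_alg (Suc k)"
  by (auto simp: cd_alg_def cd_pair_def)

lemma cd_pair_fst_snd: "x \<in> cd_alg (Suc k) \<Longrightarrow> cd_pair k (cd_fst k x) (cd_snd k x) = x"
  by (auto simp: cd_alg_def cd_fst_def cd_snd_def cd_pair_def fun_eq_iff)

lemma cd_pair_bij:
  "bij_betw (\<lambda>(a, b). cd_pair k a b) (cd_alg k \<times> cd_alg k) (cd_alg (Suc k))"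
  by (rule bij_betw_byWitness[where f' = "\<lambda>x. (cd_fst k x, cd_snd k x)"])
    (auto simp: cd_pair_fst_snd)

lemma cd_pair_add: "cd_pair k a b + cd_pair k c d = cd_pair k (a + c) (b + d)"
  by (auto simp: cd_pair_def fun_eq_iff)

lemma cd_pair_scaleR: "r *\<^sub>R cd_pair k a b = cd_pair k (r *\<^sub>R a) (r *\<^sub>R b)"
  by (auto simp: cd_pair_def scaleR_fun_def fun_eq_iff)

lemma cd_pair_zero [simp]: "cd_pair k 0 0 = 0"
  by (auto simp: cd_pair_def fun_eq_iff)

lemma cd_conj_pair:
  "a \<in> cd_alg k \<Longrightarrow> b \<in> cd_alg k \<Longrightarrow> cd_conj (Suc k) (cd_pair k a b) = cd_pair k (cd_conj k a) (- b)"
  by simp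

lemma cd_mult_pair:
  assumes "a \<in> cd_alg k" "b \<in> cd_alg k" "c \<in> cd_alg k" "d \<in> cd_alg k"
  shows "cd_mult \<gamma> (Suc k) (cd_pair k a b) (cd_pair k c d) =
    cd_pair k (cd_mult \<gamma> k a c + \<gamma> k *\<^sub>R cd_mult \<gamma> k (cd_conj k d) b)
              (cd_mult \<gamma> k d a + cd_mult \<gamma> k b (cd_conj k c))"
  using assms by simp

lemma cd_conj_in_alg [simp]: "x \<in> cd_alg k \<Longrightarrow> cd_conj k x \<in> cd_alg k"
proof (cases k)
  case (Suc m)
  have "- cd_snd m x \<in> cd_alg m"
    by (simp add: cd_alg_def cd_snd_def)
  with Suc show ?thesis by simp
qed simp

lemma cd_conj_conj: "x \<in> cd_alg k \<Longrightarrow> cd_conj k (cd_conj k x) = x"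
proof (induction k arbitrary: x)
  case (Suc k)
  have "- cd_snd k x \<in> cd_alg k"
    by (simp add: cd_alg_def cd_snd_def)
  with Suc show ?case by (simp add: cd_pair_fst_snd)
qed simp

lemma cd_mult_uminus:
  "cd_mult \<gamma> k (- x) y = - cd_mult \<gamma> k x y" "cd_mult \<gamma> k x (- y) = - cd_mult \<gamma> k x y"
  "cd_conj k (- x) = - cd_conj k x"
proof (induction k arbitrary: x y)
  case (Suc k)
  have *: "cd_fst k (- z) = - cd_fst k z" "cd_snd k (- z) = - cd_snd k z" for z
    by (auto simp: cd_fst_def cd_snd_def fun_eq_iff)
  have **: "- cd_pair k u v = cd_pair k (- u) (- v)" for u v
    by (auto simp: cd_pair_def fun_eq_iff)
  { case 1 show ?case
      by (simp only: cd_mult.simps Let_def * ** Suc) (auto simp: cd_pair_def scaleR_fun_def fun_eq_iff) }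
  { case 2 show ?case
      by (simp only: cd_mult.simps Let_def * ** Suc) (auto simp: cd_pair_def scaleR_fun_def fun_eq_iff) }
  { case 3 show ?case by (simp only: cd_conj.simps * ** Suc) }
qed (auto simp: fun_eq_iff)

lemma cd_mult_conj:
  assumes "x \<in> cd_alg k"
  shows "\<exists>r. cd_mult \<gamma> k x (cd_conj k x) = r *\<^sub>R cd_basis k 0
           \<and> cd_mult \<gamma> k (cd_conj k x) x = r *\<^sub>R cd_basis k 0"
  using assms
proof (induction k arbitrary: x)
  case 0
  show ?case
    by (rule exI[of _ "x 0 * x 0"]) (auto simp: scaleR_fun_def fun_eq_iff)
next
  case (Suc k)
  define a b where "a = cd_fst k x" and "b = cd_snd k x"
  have ab: "a \<in> cd_alg k" "b \<in> cd_alg k" "- b \<in> cd_alg k"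
    by (simp_all add: a_def b_def) (simp add: cd_alg_def cd_snd_def)
  from Suc.IH[OF ab(1)] obtain r where r:
    "cd_mult \<gamma> k a (cd_conj k a) = r *\<^sub>R cd_basis k 0"
    "cd_mult \<gamma> k (cd_conj k a) a = r *\<^sub>R cd_basis k 0" by blast
  from Suc.IH[OF ab(2)] obtain s where s:
    "cd_mult \<gamma> k b (cd_conj k b) = s *\<^sub>R cd_basis k 0"
    "cd_mult \<gamma> k (cd_conj k b) b = s *\<^sub>R cd_basis k 0" by blast
  have sc: "r *\<^sub>R cd_basis k 0 - (\<gamma> k * s) *\<^sub>R cd_basis k 0 = (r - \<gamma> k * s) *\<^sub>R cd_basis k 0"
    by (simp add: scaleR_diff_left)
  show ?case
    using ab r s
    by (intro exI[of _ "r - \<gamma> k * s"])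
      (simp add: a_def[symmetric] b_def[symmetric] cd_mult_uminus cd_conj_conj sc cd_pair_scaleR)
qed

lemma cd_basis_0_neq_0: "cd_basis k 0 \<noteq> 0"
proof -
  have "cd_basis k 0 0 = 1" by (induction k) (simp_all add: cd_pair_def)
  then show ?thesis by (metis zero_fun_apply zero_neq_one)
qed

lemma cd_norm_eq:
  assumes "a \<in> cd_alg k"
  shows "cd_mult \<gamma> k a (cd_conj k a) = cd_norm \<gamma> k a *\<^sub>R cd_basis k 0"
proof -
  obtain r where "cd_mult \<gamma> k a (cd_conj k a) = r *\<^sub>R cd_basis k 0"
    using cd_mult_conj[OF assms] by blast
  then have "\<exists>!r. cd_mult \<gamma> k a (cd_conj k a) = r *\<^sub>R cd_basis k 0"
    using cd_basis_0_neq_0 by (metis scaleR_right_imp_eq)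
  then show ?thesis
    unfolding cd_norm_def by (rule theI')
qed

end

theory Submission
  imports Defs
begin

text \<open>
  Write \<open>x~\<close> for \<open>x e~\<^sub>0\<close>.  The elements \<open>a\<close>, \<open>b\<close>, \<open>a~\<close>, \<open>b~\<close> are, up to sign, distinct
  imaginary basis elements, so each is minus its conjugate, they anticommute pairwise and \<open>a\<close> and
  \<open>b\<close> have norm \<open>\<plusminus>1\<close>.  These properties alone give \<open>a a~ = - n(a) e~\<^sub>0\<close> and, although the algebra
  is not alternative, \<open>b~ a = b a~\<close>: written in the two components of \<open>A\<^sub>n\<close>, the latter is exactly
  the anticommutation of \<open>b\<close> with \<open>a\<close> and with \<open>a~\<close>.  All the products in question then vanish
  because \<open>\<gamma>\<^sub>n n(a) = \<chi> n(b)\<close>.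
\<close>

section \<open>Closure, homogeneity and the unity of the algebras\<close>

lemma cd_pair_inject:
  assumes "a \<in> cd_alg k" "b \<in> cd_alg k" "c \<in> cd_alg k" "d \<in> cd_alg k"
  shows "cd_pair k a b = cd_pair k c d \<longleftrightarrow> a = c \<and> b = d"
  using assms cd_fst_pair cd_snd_pair by metis

lemma cd_pair_uminus: "- cd_pair k a b = cd_pair k (- a) (- b)"
  by (auto simp: cd_pair_def fun_eq_iff)

lemma cd_alg_zero [simp]: "0 \<in> cd_alg k"
  by (simp add: cd_alg_def)

lemma cd_alg_add [simp]: "x \<in> cd_alg k \<Longrightarrow> y \<in> cd_alg k \<Longrightarrow> x + y \<in> cd_alg k"
  by (simp add: cd_alg_def)

lemma cd_alg_diff [simp]: "x \<in> cd_alg k \<Longrightarrow> y \<in> cd_alg k \<Longrightarrow> x - y \<in> cd_alg k"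
  by (simp add: cd_alg_def)

lemma cd_alg_uminus [simp]: "x \<in> cd_alg k \<Longrightarrow> - x \<in> cd_alg k"
  by (simp add: cd_alg_def)

lemma cd_alg_scaleR [simp]: "x \<in> cd_alg k \<Longrightarrow> r *\<^sub>R x \<in> cd_alg k"
  by (simp add: cd_alg_def scaleR_fun_def)

lemma cd_mult_in_alg [simp]: "cd_mult \<gamma> k x y \<in> cd_alg k"
proof (induction k arbitrary: x y)
  case 0
  show ?case by (simp add: cd_alg_def)
next
  case (Suc k)
  then show ?case by (simp add: Let_def)
qed

lemma cd_basis_in_alg [simp]: "cd_basis k j \<in> cd_alg k"
  by (induction k arbitrary: j) (auto simp: cd_alg_def cd_pair_def)

lemma cd_conj_scaleR [simp]: "cd_conj k (r *\<^sub>R x) = r *\<^sub>R cd_conj k x"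
proof (induction k arbitrary: x)
  case (Suc k)
  have *: "cd_fst k (r *\<^sub>R x) = r *\<^sub>R cd_fst k x" "cd_snd k (r *\<^sub>R x) = r *\<^sub>R cd_snd k x"
    by (auto simp: cd_fst_def cd_snd_def scaleR_fun_def fun_eq_iff)
  show ?case by (simp add: * Suc cd_pair_scaleR)
qed simp

lemma cd_mult_scaleR [simp]:
  "cd_mult \<gamma> k (r *\<^sub>R x) y = r *\<^sub>R cd_mult \<gamma> k x y"
  "cd_mult \<gamma> k x (r *\<^sub>R y) = r *\<^sub>R cd_mult \<gamma> k x y"
proof (induction k arbitrary: x y)
  case 0
  { case 1 show ?case by (auto simp: scaleR_fun_def fun_eq_iff) }
  { case 2 show ?case by (auto simp: scaleR_fun_def fun_eq_iff) }
next
  case (Suc k)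
  have *: "cd_fst k (r *\<^sub>R z) = r *\<^sub>R cd_fst k z" "cd_snd k (r *\<^sub>R z) = r *\<^sub>R cd_snd k z" for z
    by (auto simp: cd_fst_def cd_snd_def scaleR_fun_def fun_eq_iff)
  { case 1 show ?case
      by (simp add: Let_def * Suc cd_pair_scaleR scaleR_add_right mult.commute) }
  { case 2 show ?case
      by (simp add: Let_def * Suc cd_pair_scaleR scaleR_add_right mult.commute) }
qed

lemma cd_mult_zero [simp]: "cd_mult \<gamma> k 0 x = 0" "cd_mult \<gamma> k x 0 = 0"
  using cd_mult_scaleR(1)[of \<gamma> k 0 x x] cd_mult_scaleR(2)[of \<gamma> k x 0 x] by simp_all

lemma cd_conj_zero [simp]: "cd_conj k 0 = 0"
  using cd_conj_scaleR[of k 0 0] by simp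

lemma cd_basis_Suc_0: "cd_basis (Suc k) 0 = cd_pair k (cd_basis k 0) 0"
  by simp

lemma cd_conj_basis_0 [simp]: "cd_conj k (cd_basis k 0) = cd_basis k 0"
  by (induction k) (simp_all add: cd_conj_pair)

lemma cd_mult_basis_0 [simp]:
  assumes "x \<in> cd_alg k"
  shows "cd_mult \<gamma> k (cd_basis k 0) x = x" "cd_mult \<gamma> k x (cd_basis k 0) = x"
proof -
  \<comment> \<open>Both sides go through one induction: the second component of the left product
    \<open>(1,0)(u,v)\<close> is the right product \<open>v 1\<close>.\<close>
  have "cd_mult \<gamma> k (cd_basis k 0) x = x \<and> cd_mult \<gamma> k x (cd_basis k 0) = x"
    using assms
  proof (induction k arbitrary: x)
    case 0
    then show ?case by (auto simp: cd_alg_def fun_eq_iff)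
  next
    case (Suc k)
    obtain u v where x: "x = cd_pair k u v" and [simp]: "u \<in> cd_alg k" "v \<in> cd_alg k"
      using cd_pair_fst_snd[OF Suc.prems] cd_fst_in_alg cd_snd_in_alg by metis
    show ?case
      unfolding x cd_basis_Suc_0 by (subst (1 2) cd_mult_pair) (simp_all add: Suc.IH del: cd_mult.simps)
  qed
  then show "cd_mult \<gamma> k (cd_basis k 0) x = x" "cd_mult \<gamma> k x (cd_basis k 0) = x" by auto
qed

section \<open>Conjugation and anticommutation of basis elements\<close>

lemma cd_conj_basis:
  assumes "i < 2 ^ k" "i \<noteq> 0"
  shows "cd_conj k (cd_basis k i) = - cd_basis k i"
  using assms
proof (induction k arbitrary: i)
  case (Suc k)
  then show ?case by (simp add: cd_pair_uminus del: uminus_apply)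
qed simp

text \<open>Induction by halves: two lower indices fall to the induction hypothesis; in mixed halves
  the sign comes from conjugating the lower element, which is imaginary; two upper indices need the
  identity \<open>*\<close>.\<close>

lemma cd_mult_basis_anticommute:
  assumes "i < 2 ^ k" "j < 2 ^ k" "i \<noteq> 0" "j \<noteq> 0" "i \<noteq> j"
  shows "cd_mult \<gamma> k (cd_basis k i) (cd_basis k j) = - cd_mult \<gamma> k (cd_basis k j) (cd_basis k i)"
  using assms
proof (induction k arbitrary: i j)
  case (Suc k)
  \<comment> \<open>Here \<open>(0,e)(0,f)\<close> has first component \<open>\<gamma> k\<close>
    times \<open>conj f e\<close>. A shifted index may be 0, which the induction hypothesis does not
    cover; then one factor is the unity and the sign comes from conjugating the other.\<close>
  have *: "cd_mult \<gamma> k (cd_conj k (cd_basis k (j - 2 ^ k))) (cd_basis k (i - 2 ^ k))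
      = - cd_mult \<gamma> k (cd_conj k (cd_basis k (i - 2 ^ k))) (cd_basis k (j - 2 ^ k))"
    if "\<not> i < 2 ^ k" "\<not> j < 2 ^ k"
  proof -
    have lt: "i - 2 ^ k < 2 ^ k" "j - 2 ^ k < 2 ^ k" "i - 2 ^ k \<noteq> j - 2 ^ k"
      using Suc.prems that by auto
    show ?thesis
    proof (cases "i - 2 ^ k = 0 \<or> j - 2 ^ k = 0")
      case True
      with lt show ?thesis by (auto simp: cd_conj_basis cd_mult_uminus)
    next
      case False
      with lt Suc.IH[of "j - 2 ^ k" "i - 2 ^ k"] show ?thesis
        by (simp add: cd_conj_basis cd_mult_uminus del: uminus_apply)
    qed
  qed
  consider "i < 2 ^ k" "j < 2 ^ k" | "i < 2 ^ k" "\<not> j < 2 ^ k"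
    | "\<not> i < 2 ^ k" "j < 2 ^ k" | "\<not> i < 2 ^ k" "\<not> j < 2 ^ k" by blast
  then show ?case
  proof cases
    case 1
    with Suc.IH[of i j] Suc.prems show ?thesis
      by (simp add: Let_def cd_pair_uminus del: uminus_apply)
  next
    case 2
    with Suc.prems show ?thesis by (simp add: Let_def cd_pair_uminus cd_conj_basis cd_mult_uminus)
  next
    case 3
    with Suc.prems show ?thesis by (simp add: Let_def cd_pair_uminus cd_conj_basis cd_mult_uminus)
  next
    case 4
    with * show ?thesis by (simp add: Let_def cd_pair_uminus)
  qed
qed simp

section \<open>Norms of pairs and of basis elements\<close>

lemma cd_norm_unique:
  assumes "a \<in> cd_alg k" "cd_mult \<gamma> k a (cd_conj k a) = r *\<^sub>R cd_basis k 0"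
  shows "cd_norm \<gamma> k a = r"
  using cd_norm_eq[OF assms(1), of \<gamma>] assms(2) cd_basis_0_neq_0 by (metis scaleR_right_imp_eq)

lemma cd_norm_uminus:
  assumes "a \<in> cd_alg k"
  shows "cd_norm \<gamma> k (- a) = cd_norm \<gamma> k a"
  by (rule cd_norm_unique) (use assms cd_norm_eq[OF assms, of \<gamma>] in \<open>simp_all add: cd_mult_uminus\<close>)

lemma cd_norm_pair:
  assumes "a \<in> cd_alg k" "b \<in> cd_alg k"
  shows "cd_norm \<gamma> (Suc k) (cd_pair k a b) = cd_norm \<gamma> k a - \<gamma> k * cd_norm \<gamma> k b"
proof (rule cd_norm_unique)
  \<comment> \<open>The product rule yields \<open>conj b b\<close>, while the norm is defined by
    \<open>b conj b\<close>; \<open>cd_mult_conj\<close> provides one scalar for both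
    orders.\<close>
  obtain s where s: "cd_mult \<gamma> k b (cd_conj k b) = s *\<^sub>R cd_basis k 0"
    "cd_mult \<gamma> k (cd_conj k b) b = s *\<^sub>R cd_basis k 0"
    using cd_mult_conj[OF assms(2)] by blast
  with assms have "cd_norm \<gamma> k b = s" by (intro cd_norm_unique)
  with s have "cd_mult \<gamma> k (cd_conj k b) b = cd_norm \<gamma> k b *\<^sub>R cd_basis k 0" by simp
  then show "cd_mult \<gamma> (Suc k) (cd_pair k a b) (cd_conj (Suc k) (cd_pair k a b))
      = (cd_norm \<gamma> k a - \<gamma> k * cd_norm \<gamma> k b) *\<^sub>R cd_basis (Suc k) 0"
    using assms cd_norm_eq[OF assms(1), of \<gamma>]
    by (simp add: Let_def cd_conj_conj cd_mult_uminus cd_pair_scaleR scaleR_diff_left)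
qed (use assms in simp)

lemma cd_norm_zero [simp]: "cd_norm \<gamma> k 0 = 0"
  by (rule cd_norm_unique) simp_all

text \<open>At each doubling only one component is nonzero, so the norm is inherited up to a factor
  1 or \<open>- \<gamma> k\<close>, which is a sign.\<close>

lemma cd_norm_basis:
  assumes "\<And>k. \<gamma> k \<in> {1, -1}"
  shows "cd_norm \<gamma> k (cd_basis k i) \<in> {1, -1}"
proof (induction k arbitrary: i)
  case 0
  have "cd_norm \<gamma> 0 (cd_basis 0 i) = 1"
    by (rule cd_norm_unique) (auto simp: cd_alg_def fun_eq_iff)
  then show ?case by simp
next
  case (Suc k)
  have "cd_norm \<gamma> (Suc k) (cd_basis (Suc k) i) =
    (if i < 2 ^ k then cd_norm \<gamma> k (cd_basis k i) else - (\<gamma> k * cd_norm \<gamma> k (cd_basis k (i - 2 ^ k))))"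
    by (simp add: cd_norm_pair)
  with Suc[of i] Suc[of "i - 2 ^ k"] assms[of k] show ?case by auto
qed

section \<open>Signed imaginary basis elements\<close>

lemma plus_minus_E2E:
  assumes "x \<in> plus_minus (cd_E2 n)"
  obtains i where "i < 2 ^ n" "i \<noteq> 0" "x = cd_basis n i \<or> x = - cd_basis n i"
proof -
  obtain y where y: "y \<in> cd_E2 n" "x = y \<or> x = - y"
    using assms unfolding plus_minus_def by blast
  then obtain i where i: "i < 2 ^ n" "y = cd_basis n i" "y \<noteq> cd_basis n 0"
    unfolding cd_E2_def by blast
  then have "i \<noteq> 0" by (cases i) auto
  with y i show thesis using that by blast
qed

lemma cd_conj_plus_minus_E2: "x \<in> plus_minus (cd_E2 n) \<Longrightarrow> cd_conj n x = - x"
  by (elim plus_minus_E2E) (auto simp: cd_conj_basis cd_mult_uminus)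

lemma cd_norm_plus_minus_E2:
  assumes "\<And>k. \<gamma> k \<in> {1, -1}" "x \<in> plus_minus (cd_E2 n)"
  shows "cd_norm \<gamma> n x \<in> {1, -1}"
proof -
  obtain i where "x = cd_basis n i \<or> x = - cd_basis n i"
    using assms(2) by (rule plus_minus_E2E)
  then have "cd_norm \<gamma> n x = cd_norm \<gamma> n (cd_basis n i)"
    by (auto simp: cd_norm_uminus)
  then show ?thesis
    using cd_norm_basis[of \<gamma> n i] assms(1) by simp
qed

lemma cd_mult_anticommute_plus_minus_E2:
  assumes "x \<in> plus_minus (cd_E2 n)" "y \<in> plus_minus (cd_E2 n)" "x \<noteq> y" "x \<noteq> - y"
  shows "cd_mult \<gamma> n x y = - cd_mult \<gamma> n y x"
proof -
  obtain i j where ij: "i < 2 ^ n" "i \<noteq> 0" "x = cd_basis n i \<or> x = - cd_basis n i"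
    "j < 2 ^ n" "j \<noteq> 0" "y = cd_basis n j \<or> y = - cd_basis n j"
    using assms(1,2) by (elim plus_minus_E2E)
  with assms(3,4) have "i \<noteq> j" by auto
  with ij cd_mult_basis_anticommute[of i n j \<gamma>] show ?thesis
    by (auto simp: cd_mult_uminus)
qed

text \<open>Turns linear independence into distinctness up to sign, the form in which
  anticommutation uses it.\<close>

lemma independent_not_uminus:
  fixes x y :: "'a::real_vector"
  assumes "independent S" "x \<in> S" "y \<in> S" "x \<noteq> y"
  shows "x \<noteq> - y"
proof
  assume "x = - y"
  moreover have "y \<in> span (S - {x})"
    using assms by (intro span_base) auto
  ultimately have "x \<in> span (S - {x})"
    using span_neg by blast
  with assms show False
    by (auto simp: dependent_def)
qed

section \<open>The tilde map in components\<close>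

lemma cd_tilde_pair:
  assumes "u \<in> cd_alg m" "v \<in> cd_alg m"
  shows "cd_tilde \<gamma> (Suc m) (cd_pair m u v) = cd_pair m (\<gamma> m *\<^sub>R v) u"
  \<comment> \<open>The index \<open>2 ^ m\<close> opens the upper half, so
    \<open>cd_te0 (Suc m)\<close> is the pair of 0 and the unity.\<close>
  using assms by (simp add: cd_tilde_def cd_te0_def Let_def)

text \<open>That \<open>x\<close> is imaginary constrains only its first component. The tilde map
  moves the second component, scaled by the nonzero \<open>\<gamma> m\<close>, into first place, so
  the same condition on the tilde of \<open>x\<close> constrains that one too.\<close>

lemma cd_imaginary_componentsE:
  assumes "x \<in> cd_alg (Suc m)" "\<gamma> m \<noteq> 0" "cd_conj (Suc m) x = - x"
    and "cd_conj (Suc m) (cd_tilde \<gamma> (Suc m) x) = - cd_tilde \<gamma> (Suc m) x"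
  obtains u v where "x = cd_pair m u v" "u \<in> cd_alg m" "v \<in> cd_alg m"
    "cd_conj m u = - u" "cd_conj m v = - v"
proof -
  obtain u v where x: "x = cd_pair m u v" and uv: "u \<in> cd_alg m" "v \<in> cd_alg m"
    using cd_pair_fst_snd[OF assms(1)] cd_fst_in_alg cd_snd_in_alg by metis
  have "cd_pair m (cd_conj m u) (- v) = cd_pair m (- u) (- v)"
    using assms(3) unfolding x cd_conj_pair[OF uv] cd_pair_uminus .
  then have u: "cd_conj m u = - u"
    using uv by (simp only: cd_pair_inject cd_conj_in_alg cd_alg_uminus)
  have sv: "\<gamma> m *\<^sub>R v \<in> cd_alg m" using uv by simp
  have "cd_pair m (\<gamma> m *\<^sub>R cd_conj m v) (- u) = cd_pair m (\<gamma> m *\<^sub>R (- v)) (- u)"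
    using assms(4) unfolding x cd_tilde_pair[OF uv] cd_conj_pair[OF sv uv(1)] cd_pair_uminus
      cd_conj_scaleR scaleR_minus_right .
  then have "\<gamma> m *\<^sub>R cd_conj m v = \<gamma> m *\<^sub>R (- v)"
    using uv by (simp only: cd_pair_inject cd_conj_in_alg cd_alg_uminus cd_alg_scaleR)
  then have "cd_conj m v = - v"
    using assms(2) by (simp only: scaleR_cancel_left) simp
  with x uv u show thesis using that by blast
qed

text \<open>For \<open>a = (u,v)\<close> with \<open>u\<close>, \<open>v\<close> imaginary, the
  first component of the product cancels and the second is \<open>u u - \<gamma> m v v\<close>,
  which is minus the norm of \<open>a\<close>.\<close>

lemma cd_mult_tilde_self:
  assumes "a \<in> cd_alg (Suc m)" "\<gamma> m \<noteq> 0"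
    and "cd_conj (Suc m) a = - a" "cd_conj (Suc m) (cd_tilde \<gamma> (Suc m) a) = - cd_tilde \<gamma> (Suc m) a"
  shows "cd_mult \<gamma> (Suc m) a (cd_tilde \<gamma> (Suc m) a) = - (cd_norm \<gamma> (Suc m) a *\<^sub>R cd_te0 (Suc m))"
proof -
  obtain u v where a: "a = cd_pair m u v" and uv [simp]: "u \<in> cd_alg m" "v \<in> cd_alg m"
    and cu: "cd_conj m u = - u" and cv: "cd_conj m v = - v"
    using cd_imaginary_componentsE[OF assms] .
  have uu: "cd_mult \<gamma> m u u = - (cd_norm \<gamma> m u *\<^sub>R cd_basis m 0)"
    using arg_cong[OF cd_norm_eq[of u m \<gamma>], of uminus] by (simp add: cu cd_mult_uminus)
  have vv: "cd_mult \<gamma> m v v = - (cd_norm \<gamma> m v *\<^sub>R cd_basis m 0)"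
    using arg_cong[OF cd_norm_eq[of v m \<gamma>], of uminus] by (simp add: cv cd_mult_uminus)
  show ?thesis
    unfolding a cd_norm_pair[OF uv] cd_tilde_pair[OF uv]
    by (simp add: cd_te0_def Let_def cu cv uu vv cd_mult_uminus cd_pair_uminus cd_pair_scaleR
        scaleR_diff_left)
qed

lemma cd_tilde_mult:
  assumes "a \<in> cd_alg (Suc m)" "b \<in> cd_alg (Suc m)" "\<gamma> m \<noteq> 0"
    and "cd_conj (Suc m) a = - a" "cd_conj (Suc m) (cd_tilde \<gamma> (Suc m) a) = - cd_tilde \<gamma> (Suc m) a"
    and "cd_conj (Suc m) b = - b" "cd_conj (Suc m) (cd_tilde \<gamma> (Suc m) b) = - cd_tilde \<gamma> (Suc m) b"
    and ab: "cd_mult \<gamma> (Suc m) a b = - cd_mult \<gamma> (Suc m) b a"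
    and tab: "cd_mult \<gamma> (Suc m) (cd_tilde \<gamma> (Suc m) a) b = - cd_mult \<gamma> (Suc m) b (cd_tilde \<gamma> (Suc m) a)"
  shows "cd_mult \<gamma> (Suc m) (cd_tilde \<gamma> (Suc m) b) a = cd_mult \<gamma> (Suc m) b (cd_tilde \<gamma> (Suc m) a)"
proof -
  obtain u v where a: "a = cd_pair m u v" and uv [simp]: "u \<in> cd_alg m" "v \<in> cd_alg m"
    "cd_conj m u = - u" "cd_conj m v = - v"
    using cd_imaginary_componentsE[of a m \<gamma>] assms by blast
  obtain p q where b: "b = cd_pair m p q" and pq [simp]: "p \<in> cd_alg m" "q \<in> cd_alg m"
    "cd_conj m p = - p" "cd_conj m q = - q"
    using cd_imaginary_componentsE[of b m \<gamma>] assms by blast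
  note ta = cd_tilde_pair[OF uv(1,2), of \<gamma>] and tb = cd_tilde_pair[OF pq(1,2), of \<gamma>]
  let ?M = "cd_mult \<gamma> m"
  \<comment> \<open>Only the first component of the anticommutation of \<open>a\<close> and
    \<open>b\<close> carries information: with imaginary \<open>u\<close>, \<open>v\<close>,
    \<open>p\<close>, \<open>q\<close> the second holds identically. The same applies to
    \<open>tab\<close> below.\<close>
  have "?M u p + \<gamma> m *\<^sub>R ?M (- q) v = - (?M p u + \<gamma> m *\<^sub>R ?M (- v) q)"
    using ab unfolding a b by (simp add: Let_def cd_pair_uminus cd_pair_inject)
  then have 1: "?M u p + ?M p u = \<gamma> m *\<^sub>R ?M v q + \<gamma> m *\<^sub>R ?M q v"
    by (simp add: cd_mult_uminus algebra_simps)
  have "\<gamma> m *\<^sub>R ?M v p + \<gamma> m *\<^sub>R ?M (- q) u = - (\<gamma> m *\<^sub>R ?M p v + \<gamma> m *\<^sub>R ?M (- u) q)"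
    using tab unfolding a b ta by (simp add: Let_def cd_pair_uminus cd_pair_inject)
  then have 2: "\<gamma> m *\<^sub>R ?M v p + \<gamma> m *\<^sub>R ?M p v = \<gamma> m *\<^sub>R ?M u q + \<gamma> m *\<^sub>R ?M q u"
    by (simp add: cd_mult_uminus algebra_simps)
  \<comment> \<open>The components of the claim are \<open>2\<close> and \<open>1\<close>
    rearranged, in crossed order: \<open>tab\<close> gives the first component and \<open>ab\<close>
    the second.\<close>
  have "\<gamma> m *\<^sub>R ?M q u + \<gamma> m *\<^sub>R ?M (- v) p = \<gamma> m *\<^sub>R ?M p v + \<gamma> m *\<^sub>R ?M (- u) q"
    using 2 by (simp add: cd_mult_uminus algebra_simps)
  moreover have "\<gamma> m *\<^sub>R ?M v q + ?M p (- u) = ?M u p + \<gamma> m *\<^sub>R ?M q (- v)"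
    using 1 by (simp add: cd_mult_uminus algebra_simps)
  ultimately show ?thesis
    unfolding a b ta tb by (simp add: Let_def cd_pair_uminus cd_mult_uminus)
qed

section \<open>Orthogonality in the next doubling\<close>

theorem lemma6p15:
  fixes \<gamma> :: "nat \<Rightarrow> real" and n :: nat and a b :: "nat \<Rightarrow> real" and \<chi> :: real
  assumes "\<And>k. \<gamma> k \<in> {1, -1}"
    and "n \<ge> 1"
    and "a \<in> cd_alg n" and "b \<in> cd_alg n"
    and "{a, b, cd_tilde \<gamma> n a, cd_tilde \<gamma> n b} \<subseteq> plus_minus (cd_E2 n)"
    and "distinct [a, b, cd_tilde \<gamma> n a, cd_tilde \<gamma> n b]"
    and "independent {a, b, cd_tilde \<gamma> n a, cd_tilde \<gamma> n b}"
    and "\<chi> = \<gamma> n * (cd_norm \<gamma> n a / cd_norm \<gamma> n b)"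
  shows "\<chi> \<in> {1, -1}
    \<and> (\<chi> = 1 \<longrightarrow>
         cd_orthogonal \<gamma> (n + 1) (cd_pair n a b) (cd_pair n a b)
       \<and> cd_orthogonal \<gamma> (n + 1) (cd_pair n a b) (cd_pair n b (\<gamma> n *\<^sub>R a)))
    \<and> (\<chi> = -1 \<longrightarrow>
         cd_orthogonal \<gamma> (n + 1) (cd_pair n a b) (cd_pair n (cd_tilde \<gamma> n a) (cd_tilde \<gamma> n b))
       \<and> cd_orthogonal \<gamma> (n + 1) (cd_pair n a b) (cd_pair n (cd_tilde \<gamma> n b) (\<gamma> n *\<^sub>R cd_tilde \<gamma> n a)))"
proof -
  \<comment> \<open>Since \<open>n\<close> is positive, the algebra of level \<open>n\<close> is
    itself a doubling, and the tilde identities are computed in its components.\<close>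
  obtain m where n: "n = Suc m" using assms(2) by (cases n) auto
  let ?ta = "cd_tilde \<gamma> n a" and ?tb = "cd_tilde \<gamma> n b"
  let ?M = "cd_mult \<gamma> n" and ?N = "cd_norm \<gamma> n"
  have \<gamma>: "\<gamma> n * \<gamma> n = 1" "\<gamma> n = 1 \<or> \<gamma> n = -1" and \<gamma>m: "\<gamma> m \<noteq> 0"
    using assms(1)[of n] assms(1)[of m] by auto
  then have \<gamma>\<gamma>: "\<gamma> n * (\<gamma> n * r) = r" for r
    by (simp flip: mult.assoc)
  note in_alg [simp] = assms(3,4)
  have t_alg [simp]: "?ta \<in> cd_alg n" "?tb \<in> cd_alg n"
    by (simp_all add: cd_tilde_def)
  have conj [simp]: "cd_conj n a = - a" "cd_conj n b = - b"
    "cd_conj n ?ta = - ?ta" "cd_conj n ?tb = - ?tb"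
    using assms(5) by (auto intro: cd_conj_plus_minus_E2)
  have Na: "?N a = 1 \<or> ?N a = -1" and Nb: "?N b = 1 \<or> ?N b = -1"
    using cd_norm_plus_minus_E2[OF assms(1)] assms(5) by auto
  \<comment> \<open>Independence rules out \<open>x = - y\<close>, so \<open>x\<close> and
    \<open>y\<close> come from different basis indices.\<close>
  have anti: "?M x y = - ?M y x"
    if "x \<in> {a, b, ?ta, ?tb}" "y \<in> {a, b, ?ta, ?tb}" "x \<noteq> y" for x y
    using that assms(5) independent_not_uminus[OF assms(7) that]
    by (intro cd_mult_anticommute_plus_minus_E2) auto
  have ba: "?M b a = - ?M a b" and taa: "?M ?ta a = - ?M a ?ta" and tbb: "?M ?tb b = - ?M b ?tb"
    and tab: "?M ?ta b = - ?M b ?ta" and tba: "?M ?tb a = - ?M a ?tb"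
    using assms(6) by (auto intro!: anti)
  have aa: "?M a a = - (?N a *\<^sub>R cd_basis n 0)" and bb: "?M b b = - (?N b *\<^sub>R cd_basis n 0)"
    using arg_cong[OF cd_norm_eq[of a n \<gamma>], of uminus] arg_cong[OF cd_norm_eq[of b n \<gamma>], of uminus]
    by (simp_all add: cd_mult_uminus)
  have ata: "?M a ?ta = - (?N a *\<^sub>R cd_te0 n)" and btb: "?M b ?tb = - (?N b *\<^sub>R cd_te0 n)"
    using cd_mult_tilde_self[of a m \<gamma>] cd_mult_tilde_self[of b m \<gamma>] \<gamma>m conj in_alg
    unfolding n by blast+
  have tilde: "?M ?tb a = ?M b ?ta"
    using cd_tilde_mult[of a m b \<gamma>] \<gamma>m conj in_alg ba tab unfolding n by simp
  have "\<chi> \<in> {1, -1}"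
    using \<gamma>(2) Na Nb assms(8) by auto
  moreover have "cd_orthogonal \<gamma> (n + 1) (cd_pair n a b) (cd_pair n a b)
      \<and> cd_orthogonal \<gamma> (n + 1) (cd_pair n a b) (cd_pair n b (\<gamma> n *\<^sub>R a))" if "\<chi> = 1"
  proof -
    have 1: "?N a = \<gamma> n * ?N b"
      using \<gamma>(2) Na Nb that unfolding assms(8) by (elim disjE; simp)
    show ?thesis
      \<comment> \<open>In each product one component cancels because \<open>a\<close> and
        \<open>b\<close> are imaginary; the other is, up to a sign,
        \<open>a a - \<gamma> n b b\<close>, which vanishes by \<open>1\<close>.\<close>
      using \<gamma>(1) 1 by (simp add: cd_orthogonal_def Let_def cd_mult_uminus aa bb ba \<gamma>\<gamma>)
  qed
  moreover have "cd_orthogonal \<gamma> (n + 1) (cd_pair n a b) (cd_pair n ?ta ?tb)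
      \<and> cd_orthogonal \<gamma> (n + 1) (cd_pair n a b) (cd_pair n ?tb (\<gamma> n *\<^sub>R ?ta))" if "\<chi> = -1"
  proof -
    have 1: "?N a = - (\<gamma> n * ?N b)"
      using \<gamma>(2) Na Nb that unfolding assms(8) by (elim disjE; simp)
    have 2: "?M a ?tb = - ?M b ?ta"
      using tilde tba by (metis minus_minus)
    show ?thesis
      \<comment> \<open>One component of each product combines \<open>?M a ?ta\<close> and
        \<open>?M b ?tb\<close>, both multiples of \<open>cd_te0 n\<close>, and vanishes by
        \<open>1\<close>. The other cancels because \<open>?M ?tb a\<close>,
        \<open>?M b ?ta\<close>, \<open>- ?M a ?tb\<close> and \<open>- ?M ?ta b\<close> all
        coincide.\<close>
      using \<gamma>(1) 1
      by (simp add: cd_orthogonal_def Let_def cd_mult_uminus ata btb taa tbb tab 2 tilde \<gamma>\<gamma>)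
  qed
  ultimately show ?thesis by blast
qed

end
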